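(* Let $\mathbb{K}$ be a field of characteristic not $2$ and let $(\mathcal{A},\bullet,\alpha)$ be a multiplicative right (or left) Hom-pre-Lie affgebra over $\mathbb{K}$. Then $\mathcal{A}$ is a multiplicative Hom-Lie affgebra with the same unary affine map $\alpha$ and the bracket $$\{a,b\}=\langle a\bullet b,\,b\bullet a,\,\alpha(b)\rangle\qquad(a,b\in\mathcal{A}).$$
   Context: An abelian heap is a set $\mathcal{A}$ with a ternary operation $\langle-,-,-\rangle$ satisfying $\langle\langle a,b,c\rangle,d,e\rangle=\langle a,b,\langle c,d,e\rangle\rangle$, $\langle a,a,b\rangle=b=\langle b,a,a\rangle$ and $\langle a,b,c\rangle=\langle c,b,a\rangle$; $\langle a_1,\dots,a_{2n+1}\rangle$ denotes any iterated application of the operation (the result does not depend on bracketing). An affine space over $\mathbb{K}$ is a non-empty abelian heap $\mathcal{A}$ with an action $\mathbb{K}\times\mathcal{A}\times\mathcal{A}\to\mathcal{A}$, $(\xi,a,b)\mapsto\xi\blacktriangleright_a b$, such that: $\xi\blacktriangleright_a-$ and $-\blacktriangleright_a b$ are heap homomorphisms ($\mathbb{K}$ being a heap via $\xi-\zeta+\gamma$); $(\xi\zeta)\blacktriangleright_a b=\xi\blacktriangleright_a(\zeta\blacktriangleright_a b)$; $\xi\blacktriangleright_a b=\langle\xi\blacktriangleright_c b,\xi\blacktriangleright_c a,a\rangle$; $0\blacktriangleright_a b=a$, $1\blacktriangleright_a b=b$. An affine map is a heap homomorphism $f$ with $f(\xi\blacktriangleright_a b)=\xi\blacktriangleright_{f(a)}f(b)$.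 A map $\mathcal{A}\times\mathcal{A}\to\mathcal{A}$ is bi-affine if it is affine in each argument. A left Hom-pre-Lie affgebra is an affine space $\mathcal{A}$ with a bi-affine map $\bullet:\mathcal{A}\times\mathcal{A}\to\mathcal{A}$ and an affine map $\alpha:\mathcal{A}\to\mathcal{A}$ such that for all $a,b,c$: $(a\bullet b)\bullet\alpha(c)=\langle\alpha(a)\bullet(b\bullet c),\alpha(b)\bullet(a\bullet c),(b\bullet a)\bullet\alpha(c)\rangle$. A right Hom-pre-Lie affgebra instead satisfies $\alpha(a)\bullet(b\bullet c)=\langle(a\bullet b)\bullet\alpha(c),(a\bullet c)\bullet\alpha(b),\alpha(a)\bullet(c\bullet b)\rangle$. Either is multiplicative if $\alpha(a\bullet b)=\alpha(a)\bullet\alpha(b)$ for all $a,b$. A Hom-Lie affgebra is a triple $(\mathcal{A},\{-,-\},\alpha)$ with $\mathcal{A}$ an affine space, $\{-,-\}:\mathcal{A}\times\mathcal{A}\to\mathcal{A}$ bi-affine, $\alpha:\mathcal{A}\to\mathcal{A}$ affine, such that for all $a,b,c$: $\langle\{a,b\},\{a,a\},\{b,a\}\rangle=\{b,b\}$ and $\langle\{\alpha(a),\{b,c\}\},\{\alpha(a),\{a,a\}\},\{\alpha(b),\{c,a\}\},\{\alpha(b),\{b,b\}\},\{\alpha(c),\{a,b\}\}\rangle=\{\alpha(c),\{c,c\}\}$. It is multiplicative if $\alpha\{a,b\}=\{\alpha(a),\alpha(b)\}$ for all $a,b$. *)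

theory Defs
  imports "HOL-Computational_Algebra.Computational_Algebra"
begin

locale abelian_heap =
  fixes A :: "'a set"
    and t :: "'a \<Rightarrow> 'a \<Rightarrow> 'a \<Rightarrow> 'a"
  assumes heap_closed: "\<lbrakk>a \<in> A; b \<in> A; c \<in> A\<rbrakk> \<Longrightarrow> t a b c \<in> A"
    and heap_assoc: "\<lbrakk>a \<in> A; b \<in> A; c \<in> A; d \<in> A; e \<in> A\<rbrakk> \<Longrightarrow>
      t (t a b c) d e = t a b (t c d e)"
    and heap_left: "\<lbrakk>a \<in> A; b \<in> A\<rbrakk> \<Longrightarrow> t a a b = b"
    and heap_right: "\<lbrakk>a \<in> A; b \<in> A\<rbrakk> \<Longrightarrow> t b a a = b"
    and heap_comm: "\<lbrakk>a \<in> A; b \<in> A; c \<in> A\<rbrakk> \<Longrightarrow> t a b c = t c b a"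

text \<open>The five-fold heap operation. In an abelian heap every other bracketing of the same
  five elements gives the same result, see \<open>heap5_right\<close> and \<open>heap5_middle\<close> below.\<close>

definition heap5 :: "('a \<Rightarrow> 'a \<Rightarrow> 'a \<Rightarrow> 'a) \<Rightarrow> 'a \<Rightarrow> 'a \<Rightarrow> 'a \<Rightarrow> 'a \<Rightarrow> 'a \<Rightarrow> 'a" where
  "heap5 t a b c d e = t (t a b c) d e"

context abelian_heap
begin

lemma heap5_right:
  assumes "a \<in> A" "b \<in> A" "c \<in> A" "d \<in> A" "e \<in> A"
  shows "heap5 t a b c d e = t a b (t c d e)"
  using assms by (simp add: heap5_def heap_assoc)

lemma heap5_middle:
  assumes "a \<in> A" "b \<in> A" "c \<in> A" "d \<in> A" "e \<in> A"
  shows "heap5 t a b c d e = t a (t b c d) e"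
proof -
  let ?x = "t a b c" and ?m = "t b c d"
  have x: "?x \<in> A" and m: "?m \<in> A" using assms by (simp_all add: heap_closed)
  have "t ?x d ?m = t ?x d (t d c b)" using assms heap_comm[of b c d] by simp
  also have "\<dots> = t (t ?x d d) c b" using assms x heap_assoc[of ?x d d c b] by simp
  also have "\<dots> = t ?x c b" using assms x by (simp add: heap_right)
  also have "\<dots> = a" using assms by (simp add: heap_assoc heap_left heap_right)
  finally have "t a ?m e = t (t ?x d ?m) ?m e" by simp
  also have "\<dots> = t ?x d (t ?m ?m e)" using assms x m heap_assoc[of ?x d ?m ?m e] by simp
  also have "\<dots> = t ?x d e" using assms m by (simp add: heap_left)
  finally show ?thesis by (simp add: heap5_def)
qed

end

definition heap_hom ::
  "'a set \<Rightarrow> ('a \<Rightarrow> 'a \<Rightarrow> 'a \<Rightarrow> 'a) \<Rightarrow> 'b set \<Rightarrow> ('b \<Rightarrow> 'b \<Rightarrow> 'b \<Rightarrow> 'b) \<Rightarrow> ('a \<Rightarrow> 'b) \<Rightarrow> bool" where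
  "heap_hom A t B s f \<longleftrightarrow> f \<in> A \<rightarrow> B \<and>
    (\<forall>a\<in>A. \<forall>b\<in>A. \<forall>c\<in>A. f (t a b c) = s (f a) (f b) (f c))"

definition scalar_heap :: "'k::ab_group_add \<Rightarrow> 'k \<Rightarrow> 'k \<Rightarrow> 'k" where
  "scalar_heap \<xi> \<zeta> \<gamma> = \<xi> - \<zeta> + \<gamma>"

text \<open>The action \<open>act \<xi> a b\<close> stands for the scalar multiple of \<open>b\<close> by \<open>\<xi>\<close> relative to the
  base point \<open>a\<close>, i.e. \<open>\<xi> \<triangleright>\<^sub>a b\<close>.\<close>

locale affine_heap_space = abelian_heap A t
  for A :: "'a set" and t :: "'a \<Rightarrow> 'a \<Rightarrow> 'a \<Rightarrow> 'a" +
  fixes act :: "'k::field \<Rightarrow> 'a \<Rightarrow> 'a \<Rightarrow> 'a"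
  assumes nonempty: "A \<noteq> {}"
    and act_hom_point: "a \<in> A \<Longrightarrow> heap_hom A t A t (\<lambda>b. act \<xi> a b)"
    and act_hom_scalar: "\<lbrakk>a \<in> A; b \<in> A\<rbrakk> \<Longrightarrow> heap_hom UNIV scalar_heap A t (\<lambda>\<xi>. act \<xi> a b)"
    and act_mult: "\<lbrakk>a \<in> A; b \<in> A\<rbrakk> \<Longrightarrow> act (\<xi> * \<zeta>) a b = act \<xi> a (act \<zeta> a b)"
    and act_base_change: "\<lbrakk>a \<in> A; b \<in> A; c \<in> A\<rbrakk> \<Longrightarrow>
      act \<xi> a b = t (act \<xi> c b) (act \<xi> c a) a"
    and act_zero: "\<lbrakk>a \<in> A; b \<in> A\<rbrakk> \<Longrightarrow> act 0 a b = a"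
    and act_one: "\<lbrakk>a \<in> A; b \<in> A\<rbrakk> \<Longrightarrow> act 1 a b = b"

definition affine_map ::
  "'a set \<Rightarrow> ('a \<Rightarrow> 'a \<Rightarrow> 'a \<Rightarrow> 'a) \<Rightarrow> ('k::field \<Rightarrow> 'a \<Rightarrow> 'a \<Rightarrow> 'a) \<Rightarrow>
   'b set \<Rightarrow> ('b \<Rightarrow> 'b \<Rightarrow> 'b \<Rightarrow> 'b) \<Rightarrow> ('k \<Rightarrow> 'b \<Rightarrow> 'b \<Rightarrow> 'b) \<Rightarrow> ('a \<Rightarrow> 'b) \<Rightarrow> bool" where
  "affine_map A t act B s act' f \<longleftrightarrow> heap_hom A t B s f \<and>
    (\<forall>\<xi>. \<forall>a\<in>A. \<forall>b\<in>A. f (act \<xi> a b) = act' \<xi> (f a) (f b))"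

definition bi_affine_map ::
  "'a set \<Rightarrow> ('a \<Rightarrow> 'a \<Rightarrow> 'a \<Rightarrow> 'a) \<Rightarrow> ('k::field \<Rightarrow> 'a \<Rightarrow> 'a \<Rightarrow> 'a) \<Rightarrow> ('a \<Rightarrow> 'a \<Rightarrow> 'a) \<Rightarrow> bool" where
  "bi_affine_map A t act m \<longleftrightarrow>
    (\<forall>a\<in>A. affine_map A t act A t act (\<lambda>b. m a b)) \<and>
    (\<forall>b\<in>A. affine_map A t act A t act (\<lambda>a. m a b))"

locale hom_affgebra = affine_heap_space A t act
  for A :: "'a set" and t :: "'a \<Rightarrow> 'a \<Rightarrow> 'a \<Rightarrow> 'a" and act :: "'k::field \<Rightarrow> 'a \<Rightarrow> 'a \<Rightarrow> 'a" +
  fixes m :: "'a \<Rightarrow> 'a \<Rightarrow> 'a" and \<alpha> :: "'a \<Rightarrow> 'a"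
  assumes bi_affine: "bi_affine_map A t act m"
    and affine: "affine_map A t act A t act \<alpha>"

locale left_hom_pre_lie_affgebra = hom_affgebra A t act m \<alpha>
  for A :: "'a set" and t :: "'a \<Rightarrow> 'a \<Rightarrow> 'a \<Rightarrow> 'a" and act :: "'k::field \<Rightarrow> 'a \<Rightarrow> 'a \<Rightarrow> 'a"
    and m :: "'a \<Rightarrow> 'a \<Rightarrow> 'a" and \<alpha> :: "'a \<Rightarrow> 'a" +
  assumes left_hom_pre_lie: "\<lbrakk>a \<in> A; b \<in> A; c \<in> A\<rbrakk> \<Longrightarrow>
    m (m a b) (\<alpha> c) = t (m (\<alpha> a) (m b c)) (m (\<alpha> b) (m a c)) (m (m b a) (\<alpha> c))"

locale right_hom_pre_lie_affgebra = hom_affgebra A t act m \<alpha>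
  for A :: "'a set" and t :: "'a \<Rightarrow> 'a \<Rightarrow> 'a \<Rightarrow> 'a" and act :: "'k::field \<Rightarrow> 'a \<Rightarrow> 'a \<Rightarrow> 'a"
    and m :: "'a \<Rightarrow> 'a \<Rightarrow> 'a" and \<alpha> :: "'a \<Rightarrow> 'a" +
  assumes right_hom_pre_lie: "\<lbrakk>a \<in> A; b \<in> A; c \<in> A\<rbrakk> \<Longrightarrow>
    m (\<alpha> a) (m b c) = t (m (m a b) (\<alpha> c)) (m (m a c) (\<alpha> b)) (m (\<alpha> a) (m c b))"

locale hom_lie_affgebra = hom_affgebra A t act br \<alpha>
  for A :: "'a set" and t :: "'a \<Rightarrow> 'a \<Rightarrow> 'a \<Rightarrow> 'a" and act :: "'k::field \<Rightarrow> 'a \<Rightarrow> 'a \<Rightarrow> 'a"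
    and br :: "'a \<Rightarrow> 'a \<Rightarrow> 'a" and \<alpha> :: "'a \<Rightarrow> 'a" +
  assumes affine_antisymmetry: "\<lbrakk>a \<in> A; b \<in> A\<rbrakk> \<Longrightarrow> t (br a b) (br a a) (br b a) = br b b"
    and affine_hom_jacobi: "\<lbrakk>a \<in> A; b \<in> A; c \<in> A\<rbrakk> \<Longrightarrow>
      heap5 t (br (\<alpha> a) (br b c)) (br (\<alpha> a) (br a a)) (br (\<alpha> b) (br c a))
        (br (\<alpha> b) (br b b)) (br (\<alpha> c) (br a b))
      = br (\<alpha> c) (br c c)"

definition hom_multiplicative :: "'a set \<Rightarrow> ('a \<Rightarrow> 'a \<Rightarrow> 'a) \<Rightarrow> ('a \<Rightarrow> 'a) \<Rightarrow> bool" where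
  "hom_multiplicative A m \<alpha> \<longleftrightarrow> (\<forall>a\<in>A. \<forall>b\<in>A. \<alpha> (m a b) = m (\<alpha> a) (\<alpha> b))"

end

theory Submission
  imports Defs "HOL-Algebra.Ring"
begin

text \<open>
  After the choice of an origin, an abelian heap is an abelian group with
  \<open>\<langle>a, b, c\<rangle> = a - b + c\<close>, and the bracket reads \<open>{a, b} = ab - ba + \<alpha> b\<close>. It is bi-affine
  because affine maps are closed under the pointwise heap operation, and \<open>{a, a} = \<alpha> a\<close>, so the
  affine antisymmetry is the cancellation of \<open>ab - ba\<close> against \<open>ba - ab\<close>.

  For the Jacobi identity, bi-affinity and multiplicativity turn \<open>{\<alpha> a, {b, c}}\<close> into the sum of
  three parts:
  \<^item> \<open>\<alpha> a (b c) + (c b) \<alpha> a - \<alpha> a (c b) - (b c) \<alpha> a\<close>, made of the nested products;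
  \<^item> \<open>\<alpha> a \<alpha> c - \<alpha> c \<alpha> a + \<alpha> b \<alpha> c - \<alpha> c \<alpha> b\<close>, two terms from the
    summand \<open>\<alpha> c\<close> of \<open>{b, c}\<close> and two from the summand \<open>\<alpha> {b, c}\<close> of the outer bracket;
  \<^item> the square \<open>\<alpha> (\<alpha> c)\<close>.

  In the alternating sum of the Jacobi identity the brackets \<open>{\<alpha> x, {x, x}}\<close> equal
  \<open>\<alpha> (\<alpha> x)\<close>, and of the squares only \<open>\<alpha> (\<alpha> c)\<close> remains, which is the
  right-hand side. The second parts cancel in the cyclic sum over \<open>a, b, c\<close>, as every commutator
  appears with both signs. So the identity amounts to the vanishing
  of the cyclic sum of the first parts; this is an affine version of Hom-Lie admissibility.
  The right Hom-pre-Lie identity rewrites \<open>\<alpha> a (b c) - \<alpha> a (c b)\<close> as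
  \<open>(a b) \<alpha> c - (a c) \<alpha> b\<close>, and the cyclic sum of these differences is that of
  \<open>(b c) \<alpha> a - (c b) \<alpha> a\<close>. The left case needs no second computation: a left Hom-pre-Lie
  affgebra is a right one for the opposite product, and the admissibility condition does not change
  when the product is reversed (although the bracket does).
\<close>

section \<open>Abelian heaps as abelian groups\<close>

context abelian_group
begin

text \<open>
  Together with associativity and commutativity, the following rules decide equations between
  formal differences. All subtractions are collected into one on each side and then multiplied out
  across the equation; cancellation of \<open>x\<close> against \<open>\<ominus> x\<close>, which ordered rewriting does not see in
  a long sum, never has to be performed.
\<close>

lemma diff_add_eq:
  "\<lbrakk>a \<in> carrier G; b \<in> carrier G; c \<in> carrier G\<rbrakk> \<Longrightarrow> (a \<ominus> b) \<oplus> c = (a \<oplus> c) \<ominus> b"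
  by (simp add: a_minus_def a_ac)

lemma add_diff_eq:
  "\<lbrakk>a \<in> carrier G; b \<in> carrier G; c \<in> carrier G\<rbrakk> \<Longrightarrow> a \<oplus> (b \<ominus> c) = (a \<oplus> b) \<ominus> c"
  by (simp add: a_minus_def a_ac)

lemma diff_diff_eq:
  "\<lbrakk>a \<in> carrier G; b \<in> carrier G; c \<in> carrier G\<rbrakk> \<Longrightarrow> (a \<ominus> b) \<ominus> c = a \<ominus> (b \<oplus> c)"
  by (simp add: a_minus_def minus_add a_ac)

lemma diff_diff_eq2:
  "\<lbrakk>a \<in> carrier G; b \<in> carrier G; c \<in> carrier G\<rbrakk> \<Longrightarrow> a \<ominus> (b \<ominus> c) = (a \<oplus> c) \<ominus> b"
  by (simp add: a_minus_def minus_add a_ac)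

lemma diff_eq_iff:
  assumes "a \<in> carrier G" "b \<in> carrier G" "c \<in> carrier G"
  shows "a \<ominus> b = c \<longleftrightarrow> a = c \<oplus> b"
proof
  assume "a \<ominus> b = c"
  then show "a = c \<oplus> b" using assms by (auto simp: a_minus_def a_assoc l_neg)
qed (use assms in \<open>simp add: a_minus_def a_assoc r_neg\<close>)

lemma eq_diff_iff:
  assumes "a \<in> carrier G" "b \<in> carrier G" "c \<in> carrier G"
  shows "c = a \<ominus> b \<longleftrightarrow> a = c \<oplus> b"
  using diff_eq_iff[OF assms] by auto

lemmas clear_differences = diff_add_eq add_diff_eq diff_diff_eq diff_diff_eq2 diff_eq_iff eq_diff_iff

end

locale pointed_abelian_heap = abelian_heap +
  fixes z
  assumes base_in: "z \<in> A"
begin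

text \<open>
  The group of vectors from the origin \<open>z\<close>. Abelian groups are the additive parts of ring records,
  so the multiplicative fields are filled with dummies.
\<close>

definition vec :: "'a ring" where
  "vec = \<lparr>carrier = A, mult = (\<lambda>x y. z), one = z, zero = z, add = (\<lambda>x y. t x z y)\<rparr>"

lemma abelian_group_vec: "abelian_group vec"
proof (rule abelian_groupI)
  fix x assume "x \<in> carrier vec"
  then show "\<exists>y\<in>carrier vec. y \<oplus>\<^bsub>vec\<^esub> x = \<zero>\<^bsub>vec\<^esub>"
    using base_in by (intro bexI[of _ "t z x z"])
      (simp_all add: vec_def heap_closed heap_assoc heap_left heap_right)
next
  fix x y w
  assume "x \<in> carrier vec" "y \<in> carrier vec" "w \<in> carrier vec"
  then show "(x \<oplus>\<^bsub>vec\<^esub> y) \<oplus>\<^bsub>vec\<^esub> w = x \<oplus>\<^bsub>vec\<^esub> (y \<oplus>\<^bsub>vec\<^esub> w)"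
    using base_in by (simp add: vec_def heap_assoc)
qed (use base_in in \<open>simp_all add: vec_def heap_closed heap_left heap_comm\<close>)

sublocale vec: abelian_group vec
  rewrites "carrier vec = A"
  using abelian_group_vec by (simp_all add: vec_def)

lemma heap_eq_vec:
  assumes "x \<in> A" "y \<in> A" "w \<in> A"
  shows "t x y w = x \<ominus>\<^bsub>vec\<^esub> y \<oplus>\<^bsub>vec\<^esub> w"
proof -
  have "\<ominus>\<^bsub>vec\<^esub> y = t z y z"
    using assms base_in vec.minus_equality[of "t z y z" y]
    by (simp add: vec_def heap_closed heap_assoc heap_left heap_right)
  then have "x \<ominus>\<^bsub>vec\<^esub> y \<oplus>\<^bsub>vec\<^esub> w = t (t x z (t z y z)) z w"
    unfolding a_minus_def by (simp add: vec_def)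
  then show ?thesis
    using assms base_in heap_assoc[of x z z y z] heap_assoc[of x y z z w]
    by (simp add: heap_closed heap_left heap_right flip: heap_assoc)
qed

text \<open>The ternary operation of an abelian heap is itself a heap homomorphism.\<close>

lemma heap_interchange:
  assumes "a \<in> A" "b \<in> A" "c \<in> A" "d \<in> A" "e \<in> A" "f \<in> A" "g \<in> A" "h \<in> A" "i \<in> A"
  shows "t (t a b c) (t d e f) (t g h i) = t (t a d g) (t b e h) (t c f i)"
  using assms by (simp add: heap_eq_vec vec.clear_differences vec.a_ac)


end

section \<open>Affine maps\<close>

context affine_heap_space
begin

lemma act_closed:
  "\<lbrakk>a \<in> A; b \<in> A\<rbrakk> \<Longrightarrow> act \<xi> a b \<in> A"
  using act_hom_point[of a \<xi>] by (auto simp: heap_hom_def)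

lemma act_heap_right:
  "\<lbrakk>a \<in> A; b \<in> A; c \<in> A; d \<in> A\<rbrakk> \<Longrightarrow> act \<xi> a (t b c d) = t (act \<xi> a b) (act \<xi> a c) (act \<xi> a d)"
  using act_hom_point[of a \<xi>] by (auto simp: heap_hom_def)

lemma act_self: "a \<in> A \<Longrightarrow> act \<xi> a a = a"
  using act_base_change[of a a a \<xi>] by (simp add: act_closed heap_left)

text \<open>
  The axioms give this only for a constant base point. Moving every base point to \<open>a\<close>
  writes \<open>act \<xi> x y\<close> as a heap expression in \<open>x\<close> and in values of the homomorphism
  \<open>act \<xi> a\<close>, which reduces the joint statement to the interchange law of the heap.
\<close>

lemma act_interchange:
  assumes "a \<in> A" "b \<in> A" "c \<in> A" "d \<in> A" "e \<in> A" "f \<in> A"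
  shows "act \<xi> (t a b c) (t d e f) = t (act \<xi> a d) (act \<xi> b e) (act \<xi> c f)"
proof -
  interpret pointed_abelian_heap A t a by unfold_locales fact
  have base: "act \<xi> x y = t (act \<xi> a y) (act \<xi> a x) x" if "x \<in> A" "y \<in> A" for x y
    using that assms act_base_change by blast
  have "act \<xi> (t a b c) (t d e f)
    = t (t (act \<xi> a d) (act \<xi> a e) (act \<xi> a f)) (t (act \<xi> a a) (act \<xi> a b) (act \<xi> a c)) (t a b c)"
    using assms by (subst base) (simp_all add: heap_closed act_heap_right)
  also have "\<dots> = t (t (act \<xi> a d) (act \<xi> a a) a) (t (act \<xi> a e) (act \<xi> a b) b) (t (act \<xi> a f) (act \<xi> a c) c)"
    using assms by (intro heap_interchange) (simp_all add: act_closed)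
  also have "\<dots> = t (act \<xi> a d) (act \<xi> b e) (act \<xi> c f)"
    using assms base[of a d] base[of b e] base[of c f] by simp
  finally show ?thesis .
qed

lemma affine_map_const:
  "c \<in> A \<Longrightarrow> affine_map A t act A t act (\<lambda>_. c)"
  by (auto simp: affine_map_def heap_hom_def heap_left act_self)

lemma affine_map_heap:
  assumes f: "affine_map A t act A t act f"
    and g: "affine_map A t act A t act g"
    and h: "affine_map A t act A t act h"
  shows "affine_map A t act A t act (\<lambda>x. t (f x) (g x) (h x))"
proof -
  obtain z where "z \<in> A" using nonempty by blast
  then interpret pointed_abelian_heap A t z by unfold_locales
  have in_A: "f x \<in> A" "g x \<in> A" "h x \<in> A" if "x \<in> A" for x
    using f g h that by (auto simp: affine_map_def heap_hom_def)
  show ?thesis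
    unfolding affine_map_def heap_hom_def
  proof (intro conjI ballI allI)
    fix a b c assume "a \<in> A" "b \<in> A" "c \<in> A"
    then show "t (f (t a b c)) (g (t a b c)) (h (t a b c))
      = t (t (f a) (g a) (h a)) (t (f b) (g b) (h b)) (t (f c) (g c) (h c))"
      using f g h by (simp add: affine_map_def heap_hom_def in_A heap_interchange)
  next
    fix \<xi> a b assume "a \<in> A" "b \<in> A"
    then show "t (f (act \<xi> a b)) (g (act \<xi> a b)) (h (act \<xi> a b))
      = act \<xi> (t (f a) (g a) (h a)) (t (f b) (g b) (h b))"
      using f g h by (simp add: affine_map_def in_A act_interchange)
  qed (simp add: in_A heap_closed)
qed

end

section \<open>The bracket of a Hom-affgebra\<close>

context hom_affgebra
begin

lemma mult_closed: "\<lbrakk>a \<in> A; b \<in> A\<rbrakk> \<Longrightarrow> m a b \<in> A"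
  using bi_affine by (auto simp: bi_affine_map_def affine_map_def heap_hom_def)

lemma twist_closed: "a \<in> A \<Longrightarrow> \<alpha> a \<in> A"
  using affine by (auto simp: affine_map_def heap_hom_def)

lemma mult_heap_right:
  "\<lbrakk>a \<in> A; b \<in> A; c \<in> A; d \<in> A\<rbrakk> \<Longrightarrow> m a (t b c d) = t (m a b) (m a c) (m a d)"
  using bi_affine by (auto simp: bi_affine_map_def affine_map_def heap_hom_def)

lemma mult_heap_left:
  "\<lbrakk>a \<in> A; b \<in> A; c \<in> A; d \<in> A\<rbrakk> \<Longrightarrow> m (t b c d) a = t (m b a) (m c a) (m d a)"
  using bi_affine by (auto simp: bi_affine_map_def affine_map_def heap_hom_def)

lemma twist_heap:
  "\<lbrakk>a \<in> A; b \<in> A; c \<in> A\<rbrakk> \<Longrightarrow> \<alpha> (t a b c) = t (\<alpha> a) (\<alpha> b) (\<alpha> c)"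
  using affine by (auto simp: affine_map_def heap_hom_def)

lemma opposite: "hom_affgebra A t act (\<lambda>a b. m b a) \<alpha>"
  using bi_affine affine by unfold_locales (auto simp: bi_affine_map_def)

definition bracket :: "'a \<Rightarrow> 'a \<Rightarrow> 'a" where
  "bracket = (\<lambda>a b. t (m a b) (m b a) (\<alpha> b))"

lemma hom_affgebra_bracket: "hom_affgebra A t act bracket \<alpha>"
proof unfold_locales
  show "bi_affine_map A t act bracket"
    using bi_affine affine unfolding bi_affine_map_def bracket_def
    by (auto intro!: affine_map_heap affine_map_const simp: twist_closed)
qed (fact affine)

lemma hom_multiplicative_bracket:
  assumes "hom_multiplicative A m \<alpha>"
  shows "hom_multiplicative A bracket \<alpha>"
  using assms by (simp add: bracket_def hom_multiplicative_def twist_heap mult_closed twist_closed)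

end

section \<open>Hom-Lie admissibility\<close>

text \<open>
  The choice of origin makes it possible to speak of sums of an even number of points. In
  \<open>two_sided a b c\<close> the inner product is reversed between the two summands: then exchanging \<open>b\<close> and
  \<open>c\<close> gives the terms with the opposite sign in \<open>{\<alpha> a, {b, c}}\<close>, while reversing all
  products only exchanges the two summands.
\<close>

locale pointed_hom_affgebra = hom_affgebra A t act m \<alpha> + pointed_abelian_heap A t z
  for A :: "'a set" and t :: "'a \<Rightarrow> 'a \<Rightarrow> 'a \<Rightarrow> 'a" and act :: "'k::field \<Rightarrow> 'a \<Rightarrow> 'a \<Rightarrow> 'a"
    and m :: "'a \<Rightarrow> 'a \<Rightarrow> 'a" and \<alpha> :: "'a \<Rightarrow> 'a" and z :: 'a
begin

definition two_sided :: "'a \<Rightarrow> 'a \<Rightarrow> 'a \<Rightarrow> 'a" where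
  "two_sided a b c = m (\<alpha> a) (m b c) \<oplus>\<^bsub>vec\<^esub> m (m c b) (\<alpha> a)"

lemma two_sided_closed: "\<lbrakk>a \<in> A; b \<in> A; c \<in> A\<rbrakk> \<Longrightarrow> two_sided a b c \<in> A"
  by (simp add: two_sided_def mult_closed twist_closed)

end

locale hom_lie_admissible_affgebra = pointed_hom_affgebra +
  assumes admissible: "\<lbrakk>a \<in> A; b \<in> A; c \<in> A\<rbrakk> \<Longrightarrow>
      two_sided a b c \<oplus>\<^bsub>vec\<^esub> two_sided b c a \<oplus>\<^bsub>vec\<^esub> two_sided c a b
    = two_sided a c b \<oplus>\<^bsub>vec\<^esub> two_sided b a c \<oplus>\<^bsub>vec\<^esub> two_sided c b a"
begin

lemma opposite_admissible: "hom_lie_admissible_affgebra A t act (\<lambda>a b. m b a) \<alpha> z"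
proof -
  interpret opp: hom_affgebra A t act "\<lambda>a b. m b a" \<alpha> by (rule opposite)
  interpret opp: pointed_hom_affgebra A t act "\<lambda>a b. m b a" \<alpha> z by unfold_locales
  have "opp.two_sided a b c = two_sided a b c" if "a \<in> A" "b \<in> A" "c \<in> A" for a b c
    using that by (simp add: opp.two_sided_def two_sided_def vec.a_comm mult_closed twist_closed)
  with admissible show ?thesis
    by unfold_locales simp
qed

lemma bracket_bracket:
  assumes mult: "hom_multiplicative A m \<alpha>"
    and in_A: "a \<in> A" "b \<in> A" "c \<in> A"
  shows "bracket (\<alpha> a) (bracket b c) = (two_sided a b c \<ominus>\<^bsub>vec\<^esub> two_sided a c b)
    \<oplus>\<^bsub>vec\<^esub> ((m (\<alpha> a) (\<alpha> c) \<oplus>\<^bsub>vec\<^esub> m (\<alpha> b) (\<alpha> c)) \<ominus>\<^bsub>vec\<^esub> (m (\<alpha> c) (\<alpha> a) \<oplus>\<^bsub>vec\<^esub> m (\<alpha> c) (\<alpha> b)))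
    \<oplus>\<^bsub>vec\<^esub> \<alpha> (\<alpha> c)"
proof -
  note closed = mult_closed twist_closed heap_closed
  have "bracket (\<alpha> a) (bracket b c) = t (t (m (\<alpha> a) (m b c)) (m (\<alpha> a) (m c b)) (m (\<alpha> a) (\<alpha> c)))
    (t (m (m b c) (\<alpha> a)) (m (m c b) (\<alpha> a)) (m (\<alpha> c) (\<alpha> a)))
    (t (m (\<alpha> b) (\<alpha> c)) (m (\<alpha> c) (\<alpha> b)) (\<alpha> (\<alpha> c)))"
    using in_A mult
    by (simp add: bracket_def mult_heap_left mult_heap_right twist_heap closed hom_multiplicative_def)
  then show ?thesis
    using in_A by (simp add: two_sided_def heap_eq_vec closed vec.clear_differences vec.a_ac)
qed

text \<open>
  The cancellation behind the Jacobi identity. The letters stand for: \<open>p, q, r\<close> and \<open>p', q', r'\<close> the positive and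
  negative nested products, \<open>xy\<close> the product of \<open>\<alpha> x\<close> and \<open>\<alpha> y\<close>, and \<open>x\<close> the square
  \<open>\<alpha> (\<alpha> x)\<close>.
\<close>

lemma cyclic_cancellation:
  assumes in_A: "p \<in> A" "q \<in> A" "r \<in> A" "p' \<in> A" "q' \<in> A" "r' \<in> A" "ab \<in> A" "ba \<in> A" "ac \<in> A"
    "ca \<in> A" "bc \<in> A" "cb \<in> A" "a \<in> A" "b \<in> A" "c \<in> A"
    and eq: "p \<oplus>\<^bsub>vec\<^esub> q \<oplus>\<^bsub>vec\<^esub> r = p' \<oplus>\<^bsub>vec\<^esub> q' \<oplus>\<^bsub>vec\<^esub> r'"
  shows "heap5 t
    ((p \<ominus>\<^bsub>vec\<^esub> p') \<oplus>\<^bsub>vec\<^esub> ((ac \<oplus>\<^bsub>vec\<^esub> bc) \<ominus>\<^bsub>vec\<^esub> (ca \<oplus>\<^bsub>vec\<^esub> cb)) \<oplus>\<^bsub>vec\<^esub> c) a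
    ((q \<ominus>\<^bsub>vec\<^esub> q') \<oplus>\<^bsub>vec\<^esub> ((ba \<oplus>\<^bsub>vec\<^esub> ca) \<ominus>\<^bsub>vec\<^esub> (ab \<oplus>\<^bsub>vec\<^esub> ac)) \<oplus>\<^bsub>vec\<^esub> a) b
    ((r \<ominus>\<^bsub>vec\<^esub> r') \<oplus>\<^bsub>vec\<^esub> ((cb \<oplus>\<^bsub>vec\<^esub> ab) \<ominus>\<^bsub>vec\<^esub> (bc \<oplus>\<^bsub>vec\<^esub> ba)) \<oplus>\<^bsub>vec\<^esub> b) = c"
proof -
  \<comment> \<open>Multiplied out, both sides of the goal contain these common summands next to those of
    the assumed equation.\<close>
  let ?k = "ac \<oplus>\<^bsub>vec\<^esub> bc \<oplus>\<^bsub>vec\<^esub> ba \<oplus>\<^bsub>vec\<^esub> ca \<oplus>\<^bsub>vec\<^esub> cb \<oplus>\<^bsub>vec\<^esub> ab \<oplus>\<^bsub>vec\<^esub> a \<oplus>\<^bsub>vec\<^esub> b \<oplus>\<^bsub>vec\<^esub> c"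
  have "(p \<oplus>\<^bsub>vec\<^esub> q \<oplus>\<^bsub>vec\<^esub> r) \<oplus>\<^bsub>vec\<^esub> ?k = (p' \<oplus>\<^bsub>vec\<^esub> q' \<oplus>\<^bsub>vec\<^esub> r') \<oplus>\<^bsub>vec\<^esub> ?k"
    by (simp only: eq)
  then show ?thesis
    using in_A by (simp add: heap5_def heap_eq_vec vec.clear_differences vec.a_ac)
qed

lemma hom_lie_affgebra_bracket:
  assumes mult: "hom_multiplicative A m \<alpha>"
  shows "hom_lie_affgebra A t act bracket \<alpha>"
proof -
  interpret br: hom_affgebra A t act bracket \<alpha> by (rule hom_affgebra_bracket)
  note closed = mult_closed twist_closed
  note nested = bracket_bracket[OF mult]
  have bracket_self: "bracket a a = \<alpha> a" if "a \<in> A" for a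
    using that by (simp add: bracket_def heap_left closed)
  have antisymmetry: "t (bracket a b) (bracket a a) (bracket b a) = bracket b b" if "a \<in> A" "b \<in> A" for a b
    unfolding bracket_self[OF that(1)] bracket_self[OF that(2)] using that
    by (simp add: bracket_def heap_eq_vec closed vec.clear_differences vec.a_ac)
  have jacobi: "heap5 t (bracket (\<alpha> a) (bracket b c)) (bracket (\<alpha> a) (bracket a a)) (bracket (\<alpha> b) (bracket c a))
      (bracket (\<alpha> b) (bracket b b)) (bracket (\<alpha> c) (bracket a b)) = bracket (\<alpha> c) (bracket c c)"
    if "a \<in> A" "b \<in> A" "c \<in> A" for a b c
    unfolding nested[OF that] nested[OF that(2,3,1)] nested[OF that(3,1,2)]
    using that admissible[OF that]
    by (simp only: bracket_self closed) (intro cyclic_cancellation; simp add: closed two_sided_closed)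
  show ?thesis
    using antisymmetry jacobi by unfold_locales
qed

end

section \<open>Hom-pre-Lie affgebras\<close>

lemma (in right_hom_pre_lie_affgebra) hom_lie_admissible:
  assumes "z \<in> A"
  shows "hom_lie_admissible_affgebra A t act m \<alpha> z"
proof -
  interpret pointed_abelian_heap A t z by unfold_locales fact
  interpret pointed_hom_affgebra A t act m \<alpha> z by unfold_locales
  have pre_lie: "m (\<alpha> a) (m b c) \<oplus>\<^bsub>vec\<^esub> m (m a c) (\<alpha> b) = m (m a b) (\<alpha> c) \<oplus>\<^bsub>vec\<^esub> m (\<alpha> a) (m c b)"
    if "a \<in> A" "b \<in> A" "c \<in> A" for a b c
    using that right_hom_pre_lie[OF that]
    by (simp add: heap_eq_vec mult_closed twist_closed vec.diff_add_eq vec.eq_diff_iff)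
  show ?thesis
  proof unfold_locales
    fix a b c assume in_A: "a \<in> A" "b \<in> A" "c \<in> A"
    \<comment> \<open>Both sides are rearrangements of the two sides of the cyclic sum of the pre-Lie identity.\<close>
    have "(m (\<alpha> a) (m b c) \<oplus>\<^bsub>vec\<^esub> m (m a c) (\<alpha> b))
        \<oplus>\<^bsub>vec\<^esub> (m (\<alpha> b) (m c a) \<oplus>\<^bsub>vec\<^esub> m (m b a) (\<alpha> c))
        \<oplus>\<^bsub>vec\<^esub> (m (\<alpha> c) (m a b) \<oplus>\<^bsub>vec\<^esub> m (m c b) (\<alpha> a))
      = (m (m a b) (\<alpha> c) \<oplus>\<^bsub>vec\<^esub> m (\<alpha> a) (m c b))
        \<oplus>\<^bsub>vec\<^esub> (m (m b c) (\<alpha> a) \<oplus>\<^bsub>vec\<^esub> m (\<alpha> b) (m a c))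
        \<oplus>\<^bsub>vec\<^esub> (m (m c a) (\<alpha> b) \<oplus>\<^bsub>vec\<^esub> m (\<alpha> c) (m b a))"
      by (simp only: pre_lie in_A)
    then show "two_sided a b c \<oplus>\<^bsub>vec\<^esub> two_sided b c a \<oplus>\<^bsub>vec\<^esub> two_sided c a b
      = two_sided a c b \<oplus>\<^bsub>vec\<^esub> two_sided b a c \<oplus>\<^bsub>vec\<^esub> two_sided c b a"
      using in_A by (simp add: two_sided_def mult_closed twist_closed vec.a_ac)
  qed
qed

lemma (in left_hom_pre_lie_affgebra) opposite_right_hom_pre_lie:
  "right_hom_pre_lie_affgebra A t act (\<lambda>a b. m b a) \<alpha>"
proof -
  interpret opp: hom_affgebra A t act "\<lambda>a b. m b a" \<alpha> by (rule opposite)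
  show ?thesis by unfold_locales (rule left_hom_pre_lie)
qed

theorem proposition4p4:
  fixes A :: "'a set"
    and t :: "'a \<Rightarrow> 'a \<Rightarrow> 'a \<Rightarrow> 'a"
    and act :: "'k::field \<Rightarrow> 'a \<Rightarrow> 'a \<Rightarrow> 'a"
    and m :: "'a \<Rightarrow> 'a \<Rightarrow> 'a"
    and \<alpha> :: "'a \<Rightarrow> 'a"
  assumes "CHAR('k) \<noteq> 2"
    and "right_hom_pre_lie_affgebra A t act m \<alpha> \<or> left_hom_pre_lie_affgebra A t act m \<alpha>"
    and "hom_multiplicative A m \<alpha>"
  shows "hom_lie_affgebra A t act (\<lambda>a b. t (m a b) (m b a) (\<alpha> b)) \<alpha>
    \<and> hom_multiplicative A (\<lambda>a b. t (m a b) (m b a) (\<alpha> b)) \<alpha>"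
proof -
  have "\<exists>z. hom_lie_admissible_affgebra A t act m \<alpha> z"
    using assms(2)
  proof
    assume "right_hom_pre_lie_affgebra A t act m \<alpha>"
    then interpret right_hom_pre_lie_affgebra A t act m \<alpha> .
    show ?thesis using nonempty hom_lie_admissible by blast
  next
    assume "left_hom_pre_lie_affgebra A t act m \<alpha>"
    then interpret left_hom_pre_lie_affgebra A t act m \<alpha> .
    interpret opp: right_hom_pre_lie_affgebra A t act "\<lambda>a b. m b a" \<alpha>
      by (rule opposite_right_hom_pre_lie)
    obtain z where "z \<in> A" using nonempty by blast
    then interpret opp: hom_lie_admissible_affgebra A t act "\<lambda>a b. m b a" \<alpha> z
      by (rule opp.hom_lie_admissible)
    show ?thesis using opp.opposite_admissible by blast
  qed
  then obtain z where "hom_lie_admissible_affgebra A t act m \<alpha> z" ..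
  then interpret hom_lie_admissible_affgebra A t act m \<alpha> z .
  show ?thesis
    using assms(3) hom_lie_affgebra_bracket hom_multiplicative_bracket
    unfolding bracket_def by blast
qed

end
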